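(* Let $a\in\mathcal W$ and let $E_i=T(a)^i-T(a^i)$ for $i\ge1$. Then $E_1=0$ and $$E_i=T(a)E_{i-1}-H(a_-)H\big((a^{i-1})_+\big),\qquad i\ge2.$$ Moreover, for any $i\ge1$ and any integer $p\ge1$, as well as for $p=\infty$, $$\|E_i\|_p\le(i-1)\,\|a\|_{\mathcal W}^i.$$
   Context: $\mathbb Z^+$ is the set of positive integers. $\mathcal W$ is the Wiener algebra of complex Laurent series $a(z)=\sum_{i\in\mathbb Z}a_iz^i$ on the unit circle $|z|=1$ with $\|a\|_{\mathcal W}=\sum_{i\in\mathbb Z}|a_i|<\infty$; it is a Banach algebra. For $a\in\mathcal W$, $T(a)=(t_{i,j})_{i,j\in\mathbb Z^+}$ is the semi-infinite Toeplitz matrix with $t_{i,j}=a_{j-i}$. For $a\in\mathcal W$ put $a_+(z)=\sum_{i\in\mathbb Z^+}a_iz^i$ and $a_-(z)=\sum_{i\in\mathbb Z^+}a_{-i}z^i$, so that $a(z)=a_0+a_+(z)+a_-(z^{-1})$; $(a^{i-1})_+$ is obtained in this way from the Laurent series $a(z)^{i-1}$. For a power series $b(z)=\sum_{i\in\mathbb Z^+}b_iz^i$, $H(b)=(h_{i,j})_{i,j\in\mathbb Z^+}$ is the semi-infinite Hankel matrix with $h_{i,j}=b_{i+j-1}$. Semi-infinite matrices act as linear operators on $\ell^p=\ell^p(\mathbb Z^+)$, and $\|S\|_p=\sup_{\|v\|_p=1}\|Sv\|_p$ denotes the induced operator norm. *)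

theory Defs
  imports "HOL-Analysis.Analysis" "HOL-Library.Extended_Nat"
    "HOL-Computational_Algebra.Formal_Power_Series"
begin

text \<open>
  A Laurent series \<open>a(z) = \<Sum>i\<in>\<int>. a\<^sub>i z\<^sup>i\<close> is represented by its family of coefficients.
\<close>

type_synonym laurent = "int \<Rightarrow> complex"

definition wiener :: "laurent set" where
  "wiener = {a. (\<lambda>i. cmod (a i)) summable_on UNIV}"

definition wiener_norm :: "laurent \<Rightarrow> real" where
  "wiener_norm a = (\<Sum>\<^sub>\<infinity>i. cmod (a i))"

text \<open>
  Products and powers of Laurent series. On \<open>wiener\<close> the sum below converges absolutely and
  gives the coefficients of \<open>a(z) b(z)\<close> on the unit circle.
\<close>

definition laurent_mult :: "laurent \<Rightarrow> laurent \<Rightarrow> laurent" where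
  "laurent_mult a b = (\<lambda>n. \<Sum>\<^sub>\<infinity>k. a k * b (n - k))"

primrec laurent_pow :: "laurent \<Rightarrow> nat \<Rightarrow> laurent" where
  "laurent_pow a 0 = (\<lambda>n. if n = 0 then 1 else 0)"
| "laurent_pow a (Suc n) = laurent_mult a (laurent_pow a n)"

definition plus_part :: "laurent \<Rightarrow> complex fps" where
  "plus_part a = Abs_fps (\<lambda>i. if i = 0 then 0 else a (int i))"

definition minus_part :: "laurent \<Rightarrow> complex fps" where
  "minus_part a = Abs_fps (\<lambda>i. if i = 0 then 0 else a (- int i))"

text \<open>
  Semi-infinite matrices and vectors, indexed by the positive integers in the mathematics, are
  indexed from 0 here: position \<open>i :: nat\<close> stands for the positive integer \<open>i + 1\<close>. Hence the
  Toeplitz entries are still \<open>a\<^sub>j\<^sub>-\<^sub>i\<close>, while the Hankel entry \<open>b\<^sub>i\<^sub>+\<^sub>j\<^sub>-\<^sub>1\<close> becomes \<open>b\<^sub>i\<^sub>+\<^sub>j\<^sub>+\<^sub>1\<close>.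
\<close>

type_synonym smat = "nat \<Rightarrow> nat \<Rightarrow> complex"

definition toeplitz :: "laurent \<Rightarrow> smat" where
  "toeplitz a = (\<lambda>i j. a (int j - int i))"

definition hankel :: "complex fps \<Rightarrow> smat" where
  "hankel b = (\<lambda>i j. fps_nth b (i + j + 1))"

definition smat_mult :: "smat \<Rightarrow> smat \<Rightarrow> smat" where
  "smat_mult A B = (\<lambda>i j. \<Sum>\<^sub>\<infinity>k. A i k * B k j)"

primrec smat_pow :: "smat \<Rightarrow> nat \<Rightarrow> smat" where
  "smat_pow A 0 = (\<lambda>i j. if i = j then 1 else 0)"
| "smat_pow A (Suc n) = smat_mult A (smat_pow A n)"

definition smat_apply :: "smat \<Rightarrow> (nat \<Rightarrow> complex) \<Rightarrow> (nat \<Rightarrow> complex)" where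
  "smat_apply A v = (\<lambda>i. \<Sum>\<^sub>\<infinity>j. A i j * v j)"

text \<open>
  The norm on \<open>\<ell>\<^sup>p\<close> for \<open>p \<in> {1, 2, \<dots>} \<union> {\<infinity>}\<close>, with value \<open>\<infinity>\<close> on sequences outside \<open>\<ell>\<^sup>p\<close>.
\<close>

definition lp_norm :: "enat \<Rightarrow> (nat \<Rightarrow> complex) \<Rightarrow> ennreal" where
  "lp_norm p v =
     (case p of
        enat n \<Rightarrow>
          (if (\<lambda>i. cmod (v i) ^ n) summable_on UNIV
           then ennreal (root n (\<Sum>\<^sub>\<infinity>i. cmod (v i) ^ n)) else \<infinity>)
      | \<infinity> \<Rightarrow> (SUP i. ennreal (cmod (v i))))"

text \<open>
  Since \<open>infsum\<close> is 0 for divergent families, a matrix for which some \<open>A v\<close> is undefined is given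
  norm \<open>\<infinity>\<close> explicitly. So a finite value says that \<open>A\<close> is a bounded operator on \<open>\<ell>\<^sup>p\<close>.
\<close>

definition lp_opnorm :: "enat \<Rightarrow> smat \<Rightarrow> ennreal" where
  "lp_opnorm p A =
     (SUP v \<in> {v. lp_norm p v = 1}.
        if \<forall>i. (\<lambda>j. A i j * v j) summable_on UNIV then lp_norm p (smat_apply A v) else \<infinity>)"

end

theory Submission
  imports Defs
begin

text \<open>
  Toeplitz and Hankel matrices with symbol in the Wiener algebra have all absolute row and column
  sums bounded by the Wiener norm. Such bounds add under differences and multiply under products,
  and by the Schur test a common bound on the absolute row and column sums bounds the operator norm
  on every \<open>\<ell>\<^sup>p\<close>. The recurrence follows from \<open>T(a)T(b) = T(ab) - H(a\<^sub>-)H(b\<^sub>+)\<close>, and by induction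
  along it the row and column sums of \<open>E\<^sub>i\<close> are at most \<open>(i - 1) \<parallel>a\<parallel>\<^sup>i\<close>.
\<close>

section \<open>A weighted power inequality and estimates for series\<close>

text \<open>Jensen's inequality for the convex function x^(m+1) on the half-line, with weights w_i /
  W where W is the total weight, cleared of denominators. If W = 0, all weights vanish and both
  sides are 0.\<close>

lemma power_sum_le_sum_power:
  fixes w x :: "'a \<Rightarrow> real"
  assumes "finite S" "\<And>i. i \<in> S \<Longrightarrow> w i \<ge> 0" "\<And>i. i \<in> S \<Longrightarrow> x i \<ge> 0"
  shows "(\<Sum>i\<in>S. w i * x i) ^ Suc m \<le> (\<Sum>i\<in>S. w i) ^ m * (\<Sum>i\<in>S. w i * x i ^ Suc m)"
proof (cases "(\<Sum>i\<in>S. w i) = 0")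
  case True
  then have "w i = 0" if "i \<in> S" for i
    using assms that by (simp add: sum_nonneg_eq_0_iff)
  then show ?thesis by simp
next
  case False
  define W where "W = (\<Sum>i\<in>S. w i)"
  have "W > 0"
    using False assms by (simp add: W_def order_less_le sum_nonneg)
  have "convex_on {0::real..} (\<lambda>x. x ^ Suc m)"
    using convex_power_odd[of "Suc m"] convex_on_subset[OF convex_power_even[of "Suc m"]]
    by (cases "even (Suc m)") (simp_all del: power_Suc even_Suc)
  then have "(\<Sum>i\<in>S. (w i / W) *\<^sub>R x i) ^ Suc m \<le> (\<Sum>i\<in>S. (w i / W) * x i ^ Suc m)"
    using assms \<open>W > 0\<close> False
    by (intro convex_on_sum[where C = "{0..}" and f = "\<lambda>x. x ^ Suc m"])
      (auto simp: W_def simp flip: sum_divide_distrib)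
  then have "((\<Sum>i\<in>S. w i * x i) / W) ^ Suc m \<le> (\<Sum>i\<in>S. w i * x i ^ Suc m) / W"
    by (simp add: sum_divide_distrib)
  then have "(\<Sum>i\<in>S. w i * x i) ^ Suc m \<le> ((\<Sum>i\<in>S. w i * x i ^ Suc m) / W) * W ^ Suc m"
    using \<open>W > 0\<close> by (simp add: power_divide pos_divide_le_eq del: power_Suc)
  also have "\<dots> = W ^ m * (\<Sum>i\<in>S. w i * x i ^ Suc m)"
    using \<open>W > 0\<close> by simp
  finally show ?thesis by (simp add: W_def)
qed

lemma has_sum_sum:
  fixes f :: "'j \<Rightarrow> 'a \<Rightarrow> 'b::topological_comm_monoid_add"
  assumes "\<And>j. j \<in> F \<Longrightarrow> (f j has_sum s j) A"
  shows "((\<lambda>x. \<Sum>j\<in>F. f j x) has_sum (\<Sum>j\<in>F. s j)) A"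
  using assms by (induction F rule: infinite_finite_induct) (auto intro: has_sum_add)

lemma summable_on_sum:
  fixes f :: "'j \<Rightarrow> 'a \<Rightarrow> 'b::topological_comm_monoid_add"
  assumes "\<And>j. j \<in> F \<Longrightarrow> f j summable_on A"
  shows "(\<lambda>x. \<Sum>j\<in>F. f j x) summable_on A"
  using has_sum_sum[where F = F and f = f and A = A] assms unfolding summable_on_def by metis

lemma infsum_sum:
  fixes f :: "'j \<Rightarrow> 'a \<Rightarrow> 'b::{topological_comm_monoid_add, t2_space}"
  assumes "\<And>j. j \<in> F \<Longrightarrow> f j summable_on A"
  shows "(\<Sum>\<^sub>\<infinity>x\<in>A. \<Sum>j\<in>F. f j x) = (\<Sum>j\<in>F. \<Sum>\<^sub>\<infinity>x\<in>A. f j x)"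
  using assms by (intro infsumI has_sum_sum) auto

lemma abs_summable_on_bounded_mult:
  fixes f g :: "'a \<Rightarrow> complex"
  assumes "(\<lambda>k. cmod (f k)) summable_on A" "\<And>k. k \<in> A \<Longrightarrow> cmod (g k) \<le> D"
  shows "(\<lambda>k. cmod (f k * g k)) summable_on A"
proof (rule Infinite_Sum.abs_summable_on_comparison_test)
  show "(\<lambda>k. cmod (f k * complex_of_real D)) summable_on A"
    using assms(1) by (auto simp: norm_mult intro: summable_on_cmult_left)
  show "norm (f k * g k) \<le> norm (f k * complex_of_real D)" if "k \<in> A" for k
    using assms(2)[OF that] by (auto simp: norm_mult intro!: mult_left_mono)
qed

text \<open>The triangle inequality, followed by exchanging a finite sum with a convergent series;
  keeping \<open>F\<close> finite avoids any interchange of two infinite sums. This one estimate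
  yields submultiplicativity both of absolute row sums and of the Wiener norm.\<close>

lemma sum_norm_infsum_mult_le:
  fixes f :: "'k \<Rightarrow> complex" and g :: "'k \<Rightarrow> 'j \<Rightarrow> complex"
  assumes f: "(\<lambda>k. cmod (f k)) summable_on UNIV" "(\<Sum>\<^sub>\<infinity>k. cmod (f k)) \<le> C"
    and "finite F" and g: "\<And>k. (\<Sum>j\<in>F. cmod (g k j)) \<le> D"
  shows "(\<Sum>j\<in>F. cmod (\<Sum>\<^sub>\<infinity>k. f k * g k j)) \<le> C * D"
proof -
  have "0 \<le> D" by (rule order_trans[OF _ g]) (simp add: sum_nonneg)
  have "cmod (g k j) \<le> D" if "j \<in> F" for k j
    using member_le_sum[OF that, of "\<lambda>j. cmod (g k j)"] g[of k] \<open>finite F\<close> by auto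
  then have summ: "(\<lambda>k. cmod (f k * g k j)) summable_on UNIV" if "j \<in> F" for j
    by (rule abs_summable_on_bounded_mult[OF f(1)]) (use that in blast)
  have "(\<Sum>j\<in>F. cmod (\<Sum>\<^sub>\<infinity>k. f k * g k j)) \<le> (\<Sum>j\<in>F. \<Sum>\<^sub>\<infinity>k. cmod (f k * g k j))"
    by (intro sum_mono norm_infsum_bound summ)
  also have "\<dots> = (\<Sum>\<^sub>\<infinity>k. \<Sum>j\<in>F. cmod (f k * g k j))"
    by (intro infsum_sum[symmetric] summ)
  also have "\<dots> \<le> (\<Sum>\<^sub>\<infinity>k. cmod (f k) * D)"
  proof (rule infsum_mono)
    show "(\<lambda>k. \<Sum>j\<in>F. cmod (f k * g k j)) summable_on UNIV"
      by (intro summable_on_sum summ)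
    show "(\<lambda>k. cmod (f k) * D) summable_on UNIV"
      using f(1) by (rule summable_on_cmult_left)
    show "(\<Sum>j\<in>F. cmod (f k * g k j)) \<le> cmod (f k) * D" for k
      by (simp add: norm_mult g mult_left_mono flip: sum_distrib_left)
  qed
  also have "\<dots> = (\<Sum>\<^sub>\<infinity>k. cmod (f k)) * D"
    by (rule infsum_cmult_left')
  also have "\<dots> \<le> C * D"
    using f(2) \<open>0 \<le> D\<close> by (rule mult_right_mono)
  finally show ?thesis .
qed

section \<open>Absolute row and column sums of matrices\<close>

text \<open>The bound is put on finite partial sums because a bound on \<open>infsum\<close> could
  also hold for a divergent row, whose \<open>infsum\<close> is 0.\<close>

definition row_bound :: "smat \<Rightarrow> real \<Rightarrow> bool" where
  "row_bound A C \<longleftrightarrow> (\<forall>i F. finite F \<longrightarrow> (\<Sum>j\<in>F. cmod (A i j)) \<le> C)"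

text \<open>Row sums control the operator on l^infinity, column sums on l^1; one constant for both
  controls every l^p in between.\<close>

definition schur_bound :: "smat \<Rightarrow> real \<Rightarrow> bool" where
  "schur_bound A C \<longleftrightarrow> row_bound A C \<and> row_bound (\<lambda>i j. A j i) C"

lemma row_boundD: "row_bound A C \<Longrightarrow> finite F \<Longrightarrow> (\<Sum>j\<in>F. cmod (A i j)) \<le> C"
  by (simp add: row_bound_def)

lemma row_bound_nonneg: "row_bound A C \<Longrightarrow> 0 \<le> C"
  using row_boundD[of A C "{}"] by simp

lemma row_bound_summable:
  assumes "row_bound A C"
  shows "(\<lambda>j. cmod (A i j)) summable_on UNIV" "(\<Sum>\<^sub>\<infinity>j. cmod (A i j)) \<le> C"
proof -
  show *: "(\<lambda>j. cmod (A i j)) summable_on UNIV"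
    unfolding abs_summable_iff_bdd_above bdd_above_def using row_boundD[OF assms] by blast
  show "(\<Sum>\<^sub>\<infinity>j. cmod (A i j)) \<le> C"
    using infsum_le_finite_sums[OF *] row_boundD[OF assms] by blast
qed

lemma row_bound_entry: "row_bound A C \<Longrightarrow> cmod (A i j) \<le> C"
  using row_boundD[of A C "{j}" i] by simp

lemma row_bound_mult:
  assumes "row_bound A C" "row_bound B D"
  shows "row_bound (smat_mult A B) (C * D)"
  unfolding row_bound_def smat_mult_def
  by (intro allI impI sum_norm_infsum_mult_le row_bound_summable[OF assms(1)]
      row_boundD[OF assms(2)])

lemma row_bound_diff:
  assumes "row_bound A C" "row_bound B D"
  shows "row_bound (A - B) (C + D)"
  unfolding row_bound_def
proof (intro allI impI)
  fix i and F :: "nat set" assume "finite F"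
  have "(\<Sum>j\<in>F. cmod ((A - B) i j)) \<le> (\<Sum>j\<in>F. cmod (A i j) + cmod (B i j))"
    by (auto intro: sum_mono norm_triangle_ineq4)
  also have "\<dots> \<le> C + D"
    using \<open>finite F\<close> assms by (auto simp: sum.distrib intro: add_mono row_boundD)
  finally show "(\<Sum>j\<in>F. cmod ((A - B) i j)) \<le> C + D" .
qed

lemma schur_bound_mult:
  assumes "schur_bound A C" "schur_bound B D"
  shows "schur_bound (smat_mult A B) (C * D)"
proof -
  \<comment> \<open>Transposition reverses a product, so the column bound is the row bound for the
    transposed factors in the other order.\<close>
  have "(\<lambda>i j. smat_mult A B j i) = smat_mult (\<lambda>i j. B j i) (\<lambda>i j. A j i)"
    by (simp add: smat_mult_def mult.commute)
  then show ?thesis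
    using assms row_bound_mult[of A C B D] row_bound_mult[of "\<lambda>i j. B j i" D "\<lambda>i j. A j i" C]
    by (simp add: schur_bound_def mult.commute)
qed

lemma schur_bound_diff:
  assumes "schur_bound A C" "schur_bound B D"
  shows "schur_bound (A - B) (C + D)"
proof -
  have "(\<lambda>i j. (A - B) j i) = (\<lambda>i j. A j i) - (\<lambda>i j. B j i)"
    by (simp add: fun_eq_iff)
  then show ?thesis
    using assms by (simp add: schur_bound_def row_bound_diff)
qed

text \<open>Distributivity could fail where a divergent \<open>infsum\<close> takes the value 0.
  Here every entry is an absolutely convergent series, a summable row of \<open>A\<close> against a
  bounded column.\<close>

lemma smat_mult_diff_right:
  assumes "schur_bound A C" "schur_bound B D" "schur_bound B' D'"
  shows "smat_mult A (B - B') = smat_mult A B - smat_mult A B'"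
proof (intro ext)
  fix i j
  have *: "(\<lambda>k. A i k * M k j) summable_on UNIV" if "schur_bound M K" for M K
  proof -
    have A: "row_bound A C" and M: "row_bound (\<lambda>i j. M j i) K"
      using that assms(1) by (simp_all add: schur_bound_def)
    show ?thesis
      using abs_summable_on_bounded_mult[OF row_bound_summable(1)[OF A] row_bound_entry[OF M]]
      by (rule abs_summable_summable)
  qed
  show "smat_mult A (B - B') i j = (smat_mult A B - smat_mult A B') i j"
    using infsum_add[OF *[OF assms(2)] *[OF assms(3), THEN summable_on_uminus[THEN iffD2]]]
    by (simp add: smat_mult_def right_diff_distrib infsum_uminus)
qed

section \<open>The Schur test on l^p\<close>

text \<open>Let p = m + 1. The weighted power inequality with weights |A i j| and the row bound give
  |(Av)_i|^p <= C^(p-1) * sum_j |A i j| |v_j|^p. After summing over i and exchanging the sums, the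
  column bound supplies the last factor C.\<close>

lemma smat_apply_power_le:
  assumes A: "schur_bound A C" and v: "(\<lambda>j. cmod (v j) ^ Suc m) summable_on UNIV"
    and "(\<Sum>\<^sub>\<infinity>j. cmod (v j) ^ Suc m) \<le> 1" "finite F"
  shows "(\<Sum>i\<in>F. cmod (smat_apply A v i) ^ Suc m) \<le> C ^ Suc m"
proof -
  have row: "row_bound A C" and col: "row_bound (\<lambda>i j. A j i) C"
    using A by (auto simp: schur_bound_def)
  have C: "0 \<le> C" using row by (rule row_bound_nonneg)
  let ?p = "\<lambda>j. cmod (v j) ^ Suc m"
  have p: "(\<lambda>j. cmod (A i j) * ?p j) summable_on UNIV" for i
  proof (rule summable_on_comparison_test)
    show "(\<lambda>j. C * ?p j) summable_on UNIV"
      using v by (rule summable_on_cmult_right)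
  qed (use row_bound_entry[OF row] in \<open>auto intro!: mult_right_mono simp del: power_Suc\<close>)
  have "cmod (smat_apply A v i) ^ Suc m \<le> C ^ m * (\<Sum>\<^sub>\<infinity>j. cmod (A i j) * ?p j)" for i
  proof -
    define S where "S = C ^ m * (\<Sum>\<^sub>\<infinity>j. cmod (A i j) * ?p j)"
    have "0 \<le> S"
      unfolding S_def using C by (intro mult_nonneg_nonneg infsum_nonneg) auto
    \<comment> \<open>Taking the root gives a bound on the partial sums that is uniform in
      \<open>G\<close>. It yields both the absolute convergence of the series for (Av)_i and the
      bound on its value.\<close>
    have part: "(\<Sum>j\<in>G. cmod (A i j * v j)) \<le> root (Suc m) S" if "finite G" for G
    proof -
      have "(\<Sum>j\<in>G. cmod (A i j) * cmod (v j)) ^ Suc m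
          \<le> (\<Sum>j\<in>G. cmod (A i j)) ^ m * (\<Sum>j\<in>G. cmod (A i j) * ?p j)"
        using that by (intro power_sum_le_sum_power) auto
      also have "\<dots> \<le> S"
        unfolding S_def using that row C p
        by (intro mult_mono power_mono row_boundD finite_sum_le_infsum sum_nonneg) auto
      finally have "root (Suc m) ((\<Sum>j\<in>G. cmod (A i j * v j)) ^ Suc m) \<le> root (Suc m) S"
        by (intro real_root_le_mono) (auto simp: norm_mult)
      then show ?thesis
        by (subst (asm) real_root_power_cancel) (auto intro: sum_nonneg)
    qed
    then have summ: "(\<lambda>j. cmod (A i j * v j)) summable_on UNIV"
      unfolding abs_summable_iff_bdd_above bdd_above_def by blast
    have "cmod (smat_apply A v i) \<le> root (Suc m) S"
      unfolding smat_apply_def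
      using norm_infsum_bound[OF summ] infsum_le_finite_sums[OF summ] part
      by (meson order_trans)
    then have "cmod (smat_apply A v i) ^ Suc m \<le> root (Suc m) S ^ Suc m"
      by (intro power_mono) auto
    also have "\<dots> = S" using \<open>0 \<le> S\<close> by (intro real_root_pow_pos2) auto
    finally show ?thesis by (simp add: S_def)
  qed
  then have "(\<Sum>i\<in>F. cmod (smat_apply A v i) ^ Suc m)
      \<le> (\<Sum>i\<in>F. C ^ m * (\<Sum>\<^sub>\<infinity>j. cmod (A i j) * ?p j))"
    by (rule sum_mono)
  also have "\<dots> = C ^ m * (\<Sum>\<^sub>\<infinity>j. \<Sum>i\<in>F. cmod (A i j) * ?p j)"
    using p by (subst infsum_sum) (auto simp: sum_distrib_left)
  also have "\<dots> \<le> C ^ m * (\<Sum>\<^sub>\<infinity>j. C * ?p j)"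
  proof (intro mult_left_mono infsum_mono)
    show "(\<lambda>j. \<Sum>i\<in>F. cmod (A i j) * ?p j) summable_on UNIV"
      using p by (rule summable_on_sum)
    show "(\<lambda>j. C * ?p j) summable_on UNIV"
      using v by (rule summable_on_cmult_right)
    show "(\<Sum>i\<in>F. cmod (A i j) * ?p j) \<le> C * ?p j" for j
      using row_boundD[OF col \<open>finite F\<close>, of j]
      by (simp add: mult_right_mono del: power_Suc flip: sum_distrib_right)
  qed (use C in auto)
  also have "\<dots> = C ^ Suc m * (\<Sum>\<^sub>\<infinity>j. ?p j)"
    by (subst infsum_cmult_right') simp
  also have "\<dots> \<le> C ^ Suc m"
    using C assms(3) by (intro mult_left_le) auto
  finally show ?thesis .
qed

text \<open>The value \<open>\<infinity>\<close> outside l^p makes norm 1 carry summability along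
  with it.\<close>

lemma lp_norm_enat_eq_1D:
  assumes "lp_norm (enat n) v = 1" "n \<ge> 1"
  shows "(\<lambda>i. cmod (v i) ^ n) summable_on UNIV" "(\<Sum>\<^sub>\<infinity>i. cmod (v i) ^ n) = 1"
  using assms by (auto simp: lp_norm_def split: if_splits)

text \<open>Treats all p at once when convergence of Av is at stake: an absolutely summable row
  against a bounded vector converges absolutely.\<close>

lemma lp_norm_eq_1_entry:
  assumes "lp_norm p v = 1" "p \<ge> 1"
  shows "cmod (v i) \<le> 1"
proof (cases p)
  case (enat n)
  with assms have n: "n \<ge> 1" "lp_norm (enat n) v = 1"
    by (auto simp: one_enat_def)
  have "(\<Sum>i\<in>{i}. cmod (v i) ^ n) \<le> 1"
    using lp_norm_enat_eq_1D[OF n(2,1)]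
      finite_sum_le_infsum[of "\<lambda>i. cmod (v i) ^ n" UNIV "{i}"] by auto
  then show ?thesis
    using n(1) by (simp add: power_le_one_iff)
next
  case infinity
  have "ennreal (cmod (v i)) \<le> (SUP i. ennreal (cmod (v i)))"
    by (rule SUP_upper) simp
  with infinity assms show ?thesis
    by (simp add: lp_norm_def ennreal_le_1)
qed

text \<open>For finite p the bound on partial sums of p-th powers passes to the limit, and then to
  the root. For p = infinity it is the row bound together with |v_j| <= 1.\<close>

lemma schur_test:
  assumes A: "schur_bound A C" and "p \<ge> 1"
  shows "lp_opnorm p A \<le> ennreal C"
  unfolding lp_opnorm_def
proof (rule SUP_least)
  fix v assume "v \<in> {v. lp_norm p v = 1}"
  then have v: "lp_norm p v = 1" by simp
  have row: "row_bound A C" using A by (simp add: schur_bound_def)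
  have C: "0 \<le> C" using row by (rule row_bound_nonneg)
  note v1 = lp_norm_eq_1_entry[OF v assms(2)]
  \<comment> \<open>This excludes the branch of \<open>lp_opnorm\<close> with value
    \<open>\<infinity>\<close>.\<close>
  have summ: "(\<lambda>j. cmod (A i j * v j)) summable_on UNIV" for i
    using abs_summable_on_bounded_mult[OF row_bound_summable(1)[OF row] v1] .
  have "lp_norm p (smat_apply A v) \<le> ennreal C"
  proof (cases p)
    case (enat n)
    with assms obtain m where m: "n = Suc m"
      by (cases n) (auto simp: one_enat_def)
    have n: "lp_norm (enat n) v = 1" "n \<ge> 1" using v enat m by auto
    have part: "(\<Sum>i\<in>F. cmod (smat_apply A v i) ^ n) \<le> C ^ n" if "finite F" for F
      using smat_apply_power_le[OF A] lp_norm_enat_eq_1D[OF n] that m by simp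
    then have s: "(\<lambda>i. cmod (smat_apply A v i) ^ n) summable_on UNIV"
      by (intro nonneg_bdd_above_summable_on) (auto simp: bdd_above_def)
    have "root n (\<Sum>\<^sub>\<infinity>i. cmod (smat_apply A v i) ^ n) \<le> root n (C ^ n)"
      using n(2) part by (intro real_root_le_mono infsum_le_finite_sums s) auto
    also have "\<dots> = C" using C n(2) by (intro real_root_power_cancel) auto
    finally show ?thesis
      using s enat by (simp add: lp_norm_def ennreal_leI)
  next
    case infinity
    have "cmod (smat_apply A v i) \<le> C" for i
    proof -
      have "cmod (smat_apply A v i) \<le> (\<Sum>\<^sub>\<infinity>j. cmod (A i j * v j))"
        unfolding smat_apply_def by (rule norm_infsum_bound[OF summ])
      also have "\<dots> \<le> (\<Sum>\<^sub>\<infinity>j. cmod (A i j))"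
        using v1 by (intro infsum_mono summ row_bound_summable(1)[OF row])
          (auto simp: norm_mult mult_left_le)
      also have "\<dots> \<le> C" by (rule row_bound_summable(2)[OF row])
      finally show ?thesis .
    qed
    then show ?thesis
      using infinity by (auto simp: lp_norm_def intro!: SUP_least ennreal_leI)
  qed
  then show "(if \<forall>i. (\<lambda>j. A i j * v j) summable_on UNIV then lp_norm p (smat_apply A v) else \<infinity>)
      \<le> ennreal C"
    using abs_summable_summable[OF summ] by simp
qed

section \<open>The Wiener algebra\<close>

lemma wiener_norm_nonneg: "0 \<le> wiener_norm a"
  by (simp add: wiener_norm_def infsum_nonneg)

text \<open>Each row or column of a Toeplitz or Hankel matrix lists coefficients of its symbol
  without repetition, so this bounds all of their absolute sums.\<close>

lemma sum_inj_le_wiener_norm: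
  assumes "a \<in> wiener" "finite F" "inj_on h F"
  shows "(\<Sum>j\<in>F. cmod (a (h j))) \<le> wiener_norm a"
proof -
  have "(\<Sum>j\<in>F. cmod (a (h j))) = (\<Sum>i\<in>h ` F. cmod (a i))"
    using assms(3) by (simp add: sum.reindex)
  also have "\<dots> \<le> wiener_norm a"
    unfolding wiener_norm_def using assms
    by (intro finite_sum_le_infsum) (auto simp: wiener_def)
  finally show ?thesis .
qed

text \<open>The product estimate applied to the coefficients of \<open>a\<close> and the translates
  n -> b(n - k), each of which has finite absolute sums at most the norm of
  \<open>b\<close>.\<close>

lemma wiener_mult:
  assumes "a \<in> wiener" "b \<in> wiener"
  shows "laurent_mult a b \<in> wiener"
    and "wiener_norm (laurent_mult a b) \<le> wiener_norm a * wiener_norm b"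
proof -
  have part: "(\<Sum>n\<in>F. cmod (laurent_mult a b n)) \<le> wiener_norm a * wiener_norm b" if "finite F" for F
    unfolding laurent_mult_def
    by (rule sum_norm_infsum_mult_le)
      (use assms that in \<open>auto simp: wiener_def wiener_norm_def[symmetric] inj_on_def
         intro!: sum_inj_le_wiener_norm\<close>)
  then show *: "laurent_mult a b \<in> wiener"
    unfolding wiener_def by (auto simp: abs_summable_iff_bdd_above bdd_above_def)
  show "wiener_norm (laurent_mult a b) \<le> wiener_norm a * wiener_norm b"
    using * part unfolding wiener_norm_def wiener_def
    by (intro infsum_le_finite_sums) auto
qed

text \<open>A first power unfolds to a product with the unit, so this and its matrix analogue give
  E_1 = 0.\<close>

lemma laurent_mult_one_right: "laurent_mult a (\<lambda>n. if n = 0 then 1 else 0) = a"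
proof
  fix n
  have "laurent_mult a (\<lambda>n. if n = 0 then 1 else 0) n = (\<Sum>\<^sub>\<infinity>k\<in>{n}. a k)"
    unfolding laurent_mult_def by (rule infsum_cong_neutral) auto
  then show "laurent_mult a (\<lambda>n. if n = 0 then 1 else 0) n = a n" by simp
qed

lemma smat_mult_one_right: "smat_mult A (\<lambda>i j. if i = j then 1 else 0) = A"
proof (intro ext)
  fix i j
  have "smat_mult A (\<lambda>i j. if i = j then 1 else 0) i j = (\<Sum>\<^sub>\<infinity>k\<in>{j}. A i k)"
    unfolding smat_mult_def by (rule infsum_cong_neutral) auto
  then show "smat_mult A (\<lambda>i j. if i = j then 1 else 0) i j = A i j" by simp
qed

lemma wiener_pow:
  assumes "a \<in> wiener"
  shows "laurent_pow a (Suc n) \<in> wiener \<and>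
    wiener_norm (laurent_pow a (Suc n)) \<le> wiener_norm a ^ Suc n"
proof (induction n)
  case 0
  then show ?case using assms by (simp add: laurent_mult_one_right)
next
  case (Suc n)
  have "wiener_norm (laurent_mult a (laurent_pow a (Suc n)))
      \<le> wiener_norm a * wiener_norm (laurent_pow a (Suc n))"
    using Suc assms by (intro wiener_mult) auto
  also have "\<dots> \<le> wiener_norm a * wiener_norm a ^ Suc n"
    using Suc by (intro mult_left_mono wiener_norm_nonneg) auto
  finally show ?case
    using Suc wiener_mult(1)[OF assms] by simp
qed

section \<open>Toeplitz and Hankel matrices with symbol in the Wiener algebra\<close>

lemma schur_bound_toeplitz:
  assumes "a \<in> wiener" "wiener_norm a \<le> C"
  shows "schur_bound (toeplitz a) C"
  using assms unfolding schur_bound_def row_bound_def toeplitz_def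
  by (auto simp: inj_on_def intro!: order_trans[OF sum_inj_le_wiener_norm])

lemma schur_bound_hankel_minus:
  assumes "a \<in> wiener" "wiener_norm a \<le> C"
  shows "schur_bound (hankel (minus_part a)) C"
proof -
  \<comment> \<open>The index i + j + 1 is never 0, so the constant coefficient of
    \<open>minus_part\<close>, set to 0, does not enter.\<close>
  have *: "hankel (minus_part a) = (\<lambda>i j. a (- int (i + j + 1)))"
    by (simp add: hankel_def minus_part_def)
  show ?thesis
    using assms unfolding schur_bound_def row_bound_def *
    by (auto simp: inj_on_def intro!: order_trans[OF sum_inj_le_wiener_norm])
qed

text \<open>The free constant \<open>C\<close> allows a power of the norm of \<open>a\<close> to
  bound the Hankel matrix of a power of \<open>a\<close>.\<close>

lemma schur_bound_hankel_plus:
  assumes "a \<in> wiener" "wiener_norm a \<le> C"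
  shows "schur_bound (hankel (plus_part a)) C"
proof -
  have *: "hankel (plus_part a) = (\<lambda>i j. a (int (i + j + 1)))"
    by (simp add: hankel_def plus_part_def)
  show ?thesis
    using assms unfolding schur_bound_def row_bound_def *
    by (auto simp: inj_on_def intro!: order_trans[OF sum_inj_le_wiener_norm])
qed

text \<open>Entry (i, j) of T(ab) is the sum of a(m - i) b(j - m) over all integers m. The terms
  with m >= 0 form the entry of T(a)T(b), and those with m < 0 the entry of the Hankel
  product.\<close>

lemma toeplitz_mult:
  assumes "a \<in> wiener" "b \<in> wiener"
  shows "smat_mult (toeplitz a) (toeplitz b) =
    toeplitz (laurent_mult a b) - smat_mult (hankel (minus_part a)) (hankel (plus_part b))"
proof (intro ext)
  fix i j :: nat
  define f where "f m = a (m - int i) * b (int j - m)" for m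
  have "cmod (b k) \<le> wiener_norm b" for k
    using sum_inj_le_wiener_norm[OF assms(2), of "{k}" id] by simp
  \<comment> \<open>Convergence is what permits splitting the sum over m at 0 below.\<close>
  then have "(\<lambda>k. cmod (a k * b (int j - int i - k))) summable_on UNIV"
    using assms(1) by (intro abs_summable_on_bounded_mult) (auto simp: wiener_def)
  then have "(\<lambda>k. a k * b (int j - int i - k)) summable_on UNIV"
    by (rule abs_summable_summable)
  moreover have bij: "bij_betw (\<lambda>m. m - int i) UNIV UNIV"
    by (rule bij_betwI[where g = "\<lambda>m. m + int i"]) auto
  ultimately have f: "f summable_on UNIV"
    using summable_on_reindex_bij_betw[OF bij, of "\<lambda>k. a k * b (int j - int i - k)"]
    by (simp add: f_def[abs_def])
  have U: "UNIV = {0::int..} \<union> {..<0}" by auto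
  have "toeplitz (laurent_mult a b) i j = (\<Sum>\<^sub>\<infinity>m. f m)"
    using infsum_reindex_bij_betw[OF bij, of "\<lambda>k. a k * b (int j - int i - k)"]
    by (simp add: f_def[abs_def] toeplitz_def laurent_mult_def)
  also have "\<dots> = (\<Sum>\<^sub>\<infinity>m\<in>{0..}. f m) + (\<Sum>\<^sub>\<infinity>m\<in>{..<0}. f m)"
    by (subst U, rule infsum_Un_disjoint) (auto intro: summable_on_subset_banach[OF f])
  also have "(\<Sum>\<^sub>\<infinity>m\<in>{0..}. f m) = (\<Sum>\<^sub>\<infinity>k. f (int k))"
    by (rule infsum_reindex_bij_betw[symmetric])
      (rule bij_betwI[where g = nat], auto)
  \<comment> \<open>Writing m = -k - 1 numbers the negative integers from k = 0, which matches the
    shift by 1 in the zero-based Hankel entries.\<close>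
  also have "(\<Sum>\<^sub>\<infinity>m\<in>{..<0}. f m) = (\<Sum>\<^sub>\<infinity>k. f (- int k - 1))"
    by (rule infsum_reindex_bij_betw[symmetric])
      (rule bij_betwI[where g = "\<lambda>m. nat (- m - 1)"], auto)
  also have "(\<lambda>k. f (- int k - 1)) =
      (\<lambda>k. hankel (minus_part a) i k * hankel (plus_part b) k j)"
  proof
    fix k
    have "- int k - 1 - int i = - int (i + k + 1)" "int j - (- int k - 1) = int (k + j + 1)"
      by auto
    then show "f (- int k - 1) = hankel (minus_part a) i k * hankel (plus_part b) k j"
      by (simp only: f_def) (simp add: hankel_def minus_part_def plus_part_def)
  qed
  finally show "smat_mult (toeplitz a) (toeplitz b) i j =
    (toeplitz (laurent_mult a b) - smat_mult (hankel (minus_part a)) (hankel (plus_part b))) i j"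
    by (simp add: f_def smat_mult_def toeplitz_def)
qed

section \<open>Powers of a Toeplitz matrix and their defects\<close>

text \<open>Supplies the convergence needed to distribute T(a) over the difference defining
  E_i.\<close>

lemma schur_bound_toeplitz_pow:
  assumes "a \<in> wiener"
  shows "schur_bound (smat_pow (toeplitz a) (Suc n)) (wiener_norm a ^ Suc n)"
proof (induction n)
  case 0
  then show ?case using assms by (simp add: smat_mult_one_right schur_bound_toeplitz)
next
  case (Suc n)
  then show ?case
    using schur_bound_mult[OF schur_bound_toeplitz[OF assms order_refl]] by simp
qed

text \<open>T(a) E_(n+1) equals T(a)^(n+2) - T(a) T(a^(n+1)), and the product formula replaces the
  last term by T(a^(n+2)) minus the Hankel product.\<close>

lemma toeplitz_pow_defect_Suc:
  assumes "a \<in> wiener"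
  defines "E \<equiv> \<lambda>i. smat_pow (toeplitz a) i - toeplitz (laurent_pow a i)"
  shows "E (Suc (Suc n)) = smat_mult (toeplitz a) (E (Suc n))
    - smat_mult (hankel (minus_part a)) (hankel (plus_part (laurent_pow a (Suc n))))"
proof -
  let ?b = "laurent_pow a (Suc n)"
  have b: "?b \<in> wiener" using wiener_pow[OF assms(1)] by blast
  have "smat_mult (toeplitz a) (E (Suc n)) =
      smat_mult (toeplitz a) (smat_pow (toeplitz a) (Suc n)) - smat_mult (toeplitz a) (toeplitz ?b)"
    unfolding E_def
    by (rule smat_mult_diff_right[OF schur_bound_toeplitz[OF assms(1) order_refl]
        schur_bound_toeplitz_pow[OF assms(1)] schur_bound_toeplitz[OF b order_refl]])
  moreover have "E (Suc (Suc n)) = smat_mult (toeplitz a) (smat_pow (toeplitz a) (Suc n))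
      - toeplitz (laurent_mult a ?b)"
    by (simp add: E_def)
  ultimately show ?thesis
    unfolding toeplitz_mult[OF assms(1) b] by (simp add: fun_eq_iff)
qed

text \<open>Here n = i - 1. Each step of the recurrence multiplies the old bound by the norm of
  \<open>a\<close>, and the Hankel product adds one further copy of the new power of the
  norm.\<close>

lemma schur_bound_toeplitz_pow_defect:
  assumes "a \<in> wiener"
  shows "schur_bound (smat_pow (toeplitz a) (Suc n) - toeplitz (laurent_pow a (Suc n)))
    (real n * wiener_norm a ^ Suc n)"
proof (induction n)
  case 0
  show ?case
    by (simp add: smat_mult_one_right laurent_mult_one_right schur_bound_def row_bound_def)
next
  case (Suc n)
  have "schur_bound (smat_pow (toeplitz a) (Suc (Suc n)) - toeplitz (laurent_pow a (Suc (Suc n))))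
    (wiener_norm a * (real n * wiener_norm a ^ Suc n) + wiener_norm a * wiener_norm a ^ Suc n)"
    unfolding toeplitz_pow_defect_Suc[OF assms]
    using wiener_pow[OF assms, of n] assms
    by (intro schur_bound_diff schur_bound_mult Suc schur_bound_toeplitz
        schur_bound_hankel_minus schur_bound_hankel_plus) auto
  moreover have "wiener_norm a * (real n * wiener_norm a ^ Suc n) + wiener_norm a * wiener_norm a ^ Suc n
      = real (Suc n) * wiener_norm a ^ Suc (Suc n)"
    by (simp add: algebra_simps)
  ultimately show ?case by (simp only:)
qed

theorem theorem3p1:
  fixes a :: laurent and E :: "nat \<Rightarrow> smat"
  assumes "a \<in> wiener"
    and "\<And>i. i \<ge> 1 \<Longrightarrow> E i = smat_pow (toeplitz a) i - toeplitz (laurent_pow a i)"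
  shows "E 1 = (\<lambda>_ _. 0) \<and>
    (\<forall>i\<ge>2. E i = smat_mult (toeplitz a) (E (i - 1))
                   - smat_mult (hankel (minus_part a)) (hankel (plus_part (laurent_pow a (i - 1))))) \<and>
    (\<forall>i\<ge>1. \<forall>p::enat. p \<ge> 1 \<longrightarrow>
           lp_opnorm p (E i) \<le> ennreal ((real i - 1) * wiener_norm a ^ i))"
proof (intro conjI allI impI)
  \<comment> \<open>\<open>E 0\<close> is unspecified, so every index is brought to successor
    form.\<close>
  have E: "E (Suc n) = smat_pow (toeplitz a) (Suc n) - toeplitz (laurent_pow a (Suc n))" for n
    by (rule assms(2)) simp
  show "E 1 = (\<lambda>_ _. 0)"
    using E[of 0] by (simp add: smat_mult_one_right laurent_mult_one_right fun_eq_iff)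
  fix i :: nat
  show "E i = smat_mult (toeplitz a) (E (i - 1))
      - smat_mult (hankel (minus_part a)) (hankel (plus_part (laurent_pow a (i - 1))))" if "2 \<le> i"
  proof -
    obtain n where n: "i = Suc (Suc n)"
      using le_Suc_ex[OF \<open>2 \<le> i\<close>] by auto
    show ?thesis
      unfolding n E diff_Suc_1 by (rule toeplitz_pow_defect_Suc[OF assms(1)])
  qed
  show "lp_opnorm p (E i) \<le> ennreal ((real i - 1) * wiener_norm a ^ i)" if "1 \<le> i" "1 \<le> p" for p
  proof -
    obtain n where n: "i = Suc n"
      using \<open>1 \<le> i\<close> by (cases i) auto
    show ?thesis
      using schur_test[OF schur_bound_toeplitz_pow_defect[OF assms(1)] that(2), of n]
      unfolding n E by simp
  qed
qed

end
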